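(* Let $A_1, \dots, A_r \in M_n(\mathbb{C})$ be self-adjoint matrices. Then the set $\{A_1, \dots, A_r\}$ is variance-decomposable if and only if $$\dim\left(\mathrm{span}\left\{ I^{\mathcal{K}}, A_1^{\mathcal{K}}, \dots, A_r^{\mathcal{K}}\right\}\right) < \left(\dim \mathcal{K}\right)^2$$ for every subspace $\mathcal{K} \subset \mathbb{C}^n$ with $\dim \mathcal{K} > 1$.
   Context: $M_n(\mathbb{C})$ is the set of complex $n\times n$ matrices and $I$ is the identity matrix. A density matrix is a $D \in M_n(\mathbb{C})$ with $D \ge 0$ (positive semidefinite) and $\mathrm{Tr}\, D = 1$; the set of all density matrices is denoted $\mathcal{S}(\mathbb{C}^n)$. Projections are orthogonal projections, so a rank-one projection is in particular a density matrix. For a density matrix $D$ and self-adjoint $A_1, \dots, A_r \in M_n(\mathbb{C})$, the matrix variance $\mathrm{Var}_D(A_1, \dots, A_r) \in M_r(\mathbb{C})$ is the $r \times r$ matrix with entries $$\left[\mathrm{Var}_D(A_1,\dots,A_r)\right]_{i,j} = \mathrm{Tr}(D A_i A_j) - (\mathrm{Tr}\, D A_i)(\mathrm{Tr}\, D A_j), \qquad 1 \le i,j \le r.$$ A set $\{A_1, \dots, A_r\}$ of self-adjoint operators in $M_n(\mathbb{C})$ is called variance-decomposable if for every $D \in \mathcal{S}(\mathbb{C}^n)$ there exist finitely many rank-one projections $P_1, \dots, P_m \in M_n(\mathbb{C})$ and numbers $\lambda_1, \dots, \lambda_m \ge 0$ with $\sum_{k=1}^m \lambda_k = 1$ such that $$D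 = \sum_{k=1}^m \lambda_k P_k \quad\text{and}\quad \mathrm{Var}_D(A_1, \dots, A_r) = \sum_{k=1}^m \lambda_k \mathrm{Var}_{P_k}(A_1, \dots, A_r).$$ For a subspace $\mathcal{K} \subset \mathbb{C}^n$ (complex linear subspace, with $\dim \mathcal{K}$ its complex dimension), $Q^{\mathcal{K}} \in M_n(\mathbb{C})$ denotes the orthogonal projection onto $\mathcal{K}$, and for $A \in M_n(\mathbb{C})$ one sets $A^{\mathcal{K}} := Q^{\mathcal{K}} A Q^{\mathcal{K}}$; in particular $I^{\mathcal{K}} = Q^{\mathcal{K}}$. The span is the real linear span, taken in the real vector space $\{Q^{\mathcal{K}} A Q^{\mathcal{K}} : A \in M_n(\mathbb{C}),\ A^* = A\}$, which has real dimension $(\dim \mathcal{K})^2$, and the dimension of the span is its real dimension. *)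

theory Defs
  imports "HOL-Analysis.Analysis"
begin

(* n x n matrices are complex^'n^'n and a tuple (A_1, ..., A_r) is a function on a
   finite index type 'r. The constants vec.subspace and vec.dim refer to the complex
   vector space structure given by ( *s ); the unqualified span and dim refer to the
   real one given by ( *\<^sub>R ). *)

definition ctranspose :: "complex^'n^'m \<Rightarrow> complex^'m^'n" where
  "ctranspose A = (\<chi> i j. cnj (A $ j $ i))"

definition selfadjoint :: "complex^'n^'n \<Rightarrow> bool" where
  "selfadjoint A \<longleftrightarrow> ctranspose A = A"

definition cinner :: "complex^'n \<Rightarrow> complex^'n \<Rightarrow> complex" where
  "cinner x y = (\<Sum>i\<in>UNIV. cnj (x $ i) * y $ i)"

(* The form is real-valued for self-adjoint A, so taking Re loses nothing. *)
definition psd :: "complex^'n^'n \<Rightarrow> bool" where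
  "psd A \<longleftrightarrow> selfadjoint A \<and> (\<forall>x. 0 \<le> Re (cinner x (A *v x)))"

definition density_matrix :: "complex^'n^'n \<Rightarrow> bool" where
  "density_matrix D \<longleftrightarrow> psd D \<and> trace D = 1"

definition projection :: "complex^'n^'n \<Rightarrow> bool" where
  "projection P \<longleftrightarrow> selfadjoint P \<and> P ** P = P"

definition Var :: "complex^'n^'n \<Rightarrow> ('r::finite \<Rightarrow> complex^'n^'n) \<Rightarrow> complex^'r^'r" where
  "Var D A = (\<chi> i j. trace (D ** A i ** A j) - trace (D ** A i) * trace (D ** A j))"

definition variance_decomposable :: "('r::finite \<Rightarrow> complex^'n^'n) \<Rightarrow> bool" where
  "variance_decomposable A \<longleftrightarrow>
     (\<forall>D. density_matrix D \<longrightarrow>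
       (\<exists>(m::nat) (P :: nat \<Rightarrow> complex^'n^'n) (c :: nat \<Rightarrow> real).
          (\<forall>k<m. projection (P k) \<and> rank (P k) = 1 \<and> 0 \<le> c k) \<and>
          (\<Sum>k<m. c k) = 1 \<and>
          D = (\<Sum>k<m. c k *\<^sub>R P k) \<and>
          Var D A = (\<Sum>k<m. c k *\<^sub>R Var (P k) A)))"

(* Well defined for complex subspaces: see orth_proj_ex1 below. *)
definition orth_proj :: "(complex^'n) set \<Rightarrow> complex^'n^'n" where
  "orth_proj K = (THE Q. projection Q \<and> range ((*v) Q) = K)"

definition compress :: "(complex^'n) set \<Rightarrow> complex^'n^'n \<Rightarrow> complex^'n^'n" where
  "compress K A = orth_proj K ** A ** orth_proj K"

lemma ctranspose_mult: "ctranspose (A ** B) = ctranspose B ** ctranspose A"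
  by (simp add: ctranspose_def matrix_matrix_mult_def vec_eq_iff mult.commute)

lemma cinner_mult_left: "cinner (A *v x) y = cinner x (ctranspose A *v y)"
proof -
  have "cinner (A *v x) y = (\<Sum>i\<in>UNIV. \<Sum>j\<in>UNIV. cnj (A$i$j) * cnj (x$j) * y$i)"
    by (simp add: cinner_def matrix_vector_mult_def sum_distrib_right)
  also have "\<dots> = (\<Sum>j\<in>UNIV. \<Sum>i\<in>UNIV. cnj (A$i$j) * cnj (x$j) * y$i)"
    by (rule sum.swap)
  also have "\<dots> = cinner x (ctranspose A *v y)"
    by (simp add: cinner_def matrix_vector_mult_def ctranspose_def sum_distrib_left mult_ac)
  finally show ?thesis .
qed

lemma cinner_axis: "cinner (axis i 1) (A *v axis j 1) = A $ i $ j"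
  by (simp add: cinner_def matrix_vector_mult_def axis_def if_distrib if_distribR cong: if_cong)

lemma selfadjointI:
  assumes "\<And>x y. cinner (A *v x) y = cinner x (A *v y)"
  shows "selfadjoint A"
  unfolding selfadjoint_def vec_eq_iff
  by (metis assms cinner_axis cinner_mult_left)

lemma cinner_add_right: "cinner x (y + z) = cinner x y + cinner x z"
  by (simp add: cinner_def algebra_simps sum.distrib)

lemma cinner_add_left: "cinner (x + y) z = cinner x z + cinner y z"
  by (simp add: cinner_def algebra_simps sum.distrib)

lemma cinner_scale_left: "cinner (c *s x) y = cnj c * cinner x y"
  by (simp add: cinner_def algebra_simps sum_distrib_left)

lemma cinner_commute: "cinner x y = cnj (cinner y x)"
  by (simp add: cinner_def mult.commute)

lemma Re_cinner: "Re (cinner x y) = inner x y"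
  by (simp add: cinner_def inner_vec_def inner_complex_def)

lemma projection_unique:
  assumes "projection Q" "projection R" "range ((*v) Q) = range ((*v) R)"
  shows "Q = R"
proof -
  have absorb: "S ** T = T" if S: "projection S" and ran: "range ((*v) S) = range ((*v) T)" for S T :: "complex^'n^'n"
  proof -
    have "S *v (T *v x) = T *v x" for x
    proof -
      obtain y where "T *v x = S *v y" using ran by (metis rangeE rangeI)
      then show ?thesis
        using S by (simp add: projection_def matrix_vector_mul_assoc)
    qed
    then show ?thesis by (simp add: matrix_eq matrix_vector_mul_assoc)
  qed
  have "Q ** R = R" "R ** Q = Q" using absorb assms by metis+
  then show ?thesis
    using assms(1,2) ctranspose_mult[of Q R] by (simp add: projection_def selfadjoint_def)
qed

lemma complex_orth_decomp:
  assumes K: "vec.subspace (K :: (complex^'n) set)"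
  shows "\<exists>y\<in>K. \<forall>w\<in>K. cinner w (x - y) = 0"
proof -
  have sc: "a *\<^sub>R v = complex_of_real a *s v" for a and v :: "complex^'n"
    by (simp add: vec_eq_iff scaleR_conv_of_real[where ?'a=complex])
  have sub: "subspace K"
    unfolding subspace_def sc using K by (simp add: vec.subspace_def)
  obtain y z where y: "y \<in> span K" and z: "\<And>w. w \<in> span K \<Longrightarrow> orthogonal z w" and x: "x = y + z"
    using orthogonal_subspace_decomp_exists by blast
  have re: "Re (cinner w z) = 0" if "w \<in> K" for w
    using z[of w] that by (simp add: Re_cinner orthogonal_def inner_commute span_base)
  have "cinner w z = 0" if w: "w \<in> K" for w
  proof -
    have "\<i> *s w \<in> K" using K w by (rule vec.subspace_scale)
    from re[OF this] re[OF w] show ?thesis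
      by (simp add: cinner_scale_left complex_eq_iff)
  qed
  moreover have "y \<in> K" using y sub by (simp add: span_eq_iff[THEN iffD2])
  ultimately show ?thesis using x by (intro bexI[of _ y]) auto
qed

lemma projection_exists:
  assumes K: "vec.subspace (K :: (complex^'n) set)"
  shows "\<exists>Q. projection Q \<and> range ((*v) Q) = K"
proof -
  obtain p where p: "\<And>x. p x \<in> K" and orth: "\<And>x w. w \<in> K \<Longrightarrow> cinner w (x - p x) = 0"
    using complex_orth_decomp[OF K] by metis
  have diff: "cinner w (u - v) = cinner w u - cinner w v" for w u v :: "complex^'n"
    by (simp add: cinner_def algebra_simps sum_subtractf)
  have scr: "cinner w (c *s u) = c * cinner w u" for c and w u :: "complex^'n"
    by (simp add: cinner_def algebra_simps sum_distrib_left)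
  have uniq: "p x = y" if y: "y \<in> K" and o: "\<And>w. w \<in> K \<Longrightarrow> cinner w (x - y) = 0" for x y
  proof -
    let ?d = "p x - y"
    have d: "?d \<in> K" using K p y by (simp add: vec.subspace_diff)
    have "cinner ?d ?d = cinner ?d (x - y) - cinner ?d (x - p x)"
      by (simp add: diff)
    also have "\<dots> = 0" using o[OF d] orth[OF d] by simp
    finally have "inner ?d ?d = 0" using Re_cinner[of ?d ?d] by simp
    then show ?thesis by simp
  qed
  have lin: "Vector_Spaces.linear (*s) (*s) p"
  proof
    fix x y :: "complex^'n" and c
    show "p (x + y) = p x + p y"
    proof (rule uniq)
      show "p x + p y \<in> K" using K p by (simp add: vec.subspace_add)
      fix w assume "w \<in> K"
      then show "cinner w (x + y - (p x + p y)) = 0"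
        using orth[of w x] orth[of w y] by (simp add: diff cinner_add_right)
    qed
    show "p (c *s x) = c *s p x"
    proof (rule uniq)
      show "c *s p x \<in> K" using K p by (simp add: vec.subspace_scale)
      fix w assume "w \<in> K"
      then show "cinner w (c *s x - c *s p x) = 0"
        using orth[of w x] by (simp add: diff scr)
    qed
  qed
  define Q where "Q = matrix p"
  have Q: "Q *v x = p x" for x using lin by (simp add: Q_def matrix_works)
  have fixK: "p x = x" if "x \<in> K" for x
    using that by (intro uniq) (simp_all add: cinner_def)
  have "cinner (p x) y = cinner x (p y)" for x y
  proof -
    have "cinner (p x) y = cinner (p x) (p y)"
      using orth[OF p[of x], of y] by (simp add: diff)
    also have "\<dots> = cnj (cinner (p y) (p x))" by (rule cinner_commute)
    also have "\<dots> = cnj (cinner (p y) x)" using orth[OF p[of y], of x] by (simp add: diff)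
    also have "\<dots> = cinner x (p y)" by (rule cinner_commute[symmetric])
    finally show ?thesis .
  qed
  then have "selfadjoint Q" by (intro selfadjointI) (simp add: Q)
  moreover have "Q ** Q = Q"
    by (simp add: matrix_eq Q p fixK flip: matrix_vector_mul_assoc)
  moreover have "range ((*v) Q) = K"
    using p fixK by (auto simp: Q image_iff) metis
  ultimately show ?thesis by (auto simp: projection_def)
qed

lemma orth_proj_ex1:
  assumes "vec.subspace K"
  shows "\<exists>!Q. projection Q \<and> range ((*v) Q) = K"
  using projection_exists[OF assms] projection_unique by blast

end

theory Submission
  imports Defs
begin

text \<open>
  Var is concave in the density matrix: for a convex decomposition of \<open>D\<close> into density matrices
  \<open>P\<^sub>k\<close> the defect in the diagonal entry \<open>(i, i)\<close> is the weighted variance of the numbers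
  \<open>Tr (P\<^sub>k A\<^sub>i)\<close>. So a decomposition is admissible iff every \<open>P\<^sub>k\<close> of positive weight has
  the same expectations \<open>Tr (P\<^sub>k A\<^sub>i)\<close> as \<open>D\<close>.

  If the dimension condition holds, write \<open>D\<close> as a convex combination of extreme points of the
  compact convex set of density matrices with the expectations of \<open>D\<close> (Krein-Milman). An extreme
  point whose range \<open>K\<close> has dimension above 1 could be perturbed in both directions by a nonzero
  Hermitian matrix on \<open>K\<close> orthogonal to all the compressions; so extreme points have rank one.

  If conversely the compressions to \<open>K\<close> span all Hermitian matrices on \<open>K\<close>, the normalised projection
  onto \<open>K\<close> is the only density matrix on \<open>K\<close> with its expectations, so it has no admissible
  decomposition.
\<close>

section \<open>Self-adjoint matrices and the trace form\<close>

lemma ctranspose_nth [simp]: "ctranspose X $ i $ j = cnj (X $ j $ i)"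
  by (simp add: ctranspose_def)

lemma selfadjoint_nth: "selfadjoint X \<Longrightarrow> cnj (X $ j $ i) = X $ i $ j"
  by (metis ctranspose_nth selfadjoint_def)

lemma selfadjoint_cinner: "selfadjoint X \<Longrightarrow> cinner (X *v x) y = cinner x (X *v y)"
  by (simp add: cinner_mult_left selfadjoint_def)

lemma selfadjoint_inner: "selfadjoint X \<Longrightarrow> inner (X *v x) y = inner x (X *v y)"
  by (metis Re_cinner selfadjoint_cinner)

lemma selfadjoint_add: "selfadjoint X \<Longrightarrow> selfadjoint Y \<Longrightarrow> selfadjoint (X + Y)"
  by (simp add: selfadjoint_def vec_eq_iff)

lemma selfadjoint_scaleR: "selfadjoint X \<Longrightarrow> selfadjoint (c *\<^sub>R X)"
  by (simp add: selfadjoint_def vec_eq_iff)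

lemma selfadjoint_mat_1: "selfadjoint (mat 1)"
  by (simp add: selfadjoint_def vec_eq_iff mat_def)

lemma selfadjoint_conj:
  "selfadjoint Q \<Longrightarrow> selfadjoint X \<Longrightarrow> selfadjoint (Q ** X ** Q)"
  by (simp add: selfadjoint_def ctranspose_mult matrix_mul_assoc)

lemma scaleR_eq_smult: "a *\<^sub>R v = complex_of_real a *s v" for v :: "complex^'n"
  by (simp add: vec_eq_iff scaleR_conv_of_real[where ?'a=complex])

lemma matrix_mul_add_left: "(X + Y) ** Z = X ** Z + Y ** Z" for Z :: "complex^'p^'n"
  by (simp add: matrix_matrix_mult_def vec_eq_iff distrib_right sum.distrib)

lemma matrix_mul_sum_left: "(\<Sum>k\<in>S. X k) ** Y = (\<Sum>k\<in>S. X k ** Y)"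
  for Y :: "complex^'p^'n"
  by (simp add: vec_eq_iff matrix_matrix_mult_def sum_distrib_right sum.swap[of _ UNIV S])

lemma matrix_vector_mult_sum_left: "(\<Sum>k\<in>S. X k) *v y = (\<Sum>k\<in>S. X k *v y)"
  for y :: "complex^'n"
  by (induction S rule: infinite_finite_induct)
    (simp_all add: matrix_vector_mult_add_rdistrib)

lemma column_eq_mult_axis: "column j X = X *v axis j 1" for X :: "complex^'n^'m"
  by (simp add: vec_eq_iff column_def matrix_vector_mult_def axis_def if_distrib cong: if_cong)

lemma trace_scaleR: "trace (c *\<^sub>R X) = c *\<^sub>R trace X" for X :: "complex^'n^'n"
  by (simp add: trace_def scaleR_sum_right)

lemma trace_sum: "trace (\<Sum>k\<in>S. X k) = (\<Sum>k\<in>S. trace (X k))" for X :: "'k \<Rightarrow> complex^'n^'n"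
  by (induction S rule: infinite_finite_induct) (simp_all add: trace_add, simp_all add: trace_def)

text \<open>The real inner product of matrices is the real part of the entrywise Hermitian product,
  and the trace is real because its conjugate is the trace of the product in reverse order.
  Expectations thus become Euclidean inner products, to which hyperplanes and orthogonal complements
  apply.\<close>

lemma trace_selfadjoint_mult:
  assumes "selfadjoint X" "selfadjoint Y"
  shows "trace (X ** Y) = complex_of_real (inner X Y)"
proof -
  have 1: "inner X Y = Re (trace (X ** Y))"
  proof -
    have "inner X Y = (\<Sum>i\<in>UNIV. \<Sum>j\<in>UNIV. Re (X $ j $ i * Y $ i $ j))"
      unfolding inner_vec_def inner_complex_def
      using selfadjoint_nth[OF assms(1)]
      by (intro sum.cong refl) (metis cnj.sel mult_minus_left diff_minus_eq_add times_complex.sel(1))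
    also have "\<dots> = (\<Sum>j\<in>UNIV. \<Sum>i\<in>UNIV. Re (X $ j $ i * Y $ i $ j))"
      by (rule sum.swap)
    also have "\<dots> = Re (trace (X ** Y))"
      by (simp add: trace_def matrix_matrix_mult_def)
    finally show ?thesis .
  qed
  have "cnj (trace (X ** Y)) = trace (ctranspose (X ** Y))"
    by (simp add: trace_def)
  also have "\<dots> = trace (X ** Y)"
    using assms trace_mul_sym[of X Y] by (simp add: ctranspose_mult selfadjoint_def)
  finally show ?thesis
    using 1 by (simp add: complex_eq_iff)
qed

lemma inner_mat_1: "selfadjoint X \<Longrightarrow> trace X = complex_of_real (inner X (mat 1))"
  using trace_selfadjoint_mult[OF _ selfadjoint_mat_1, of X] by simp

section \<open>Matrices of the form \<open>outer v u\<close>\<close>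

definition outer :: "complex^'n \<Rightarrow> complex^'m \<Rightarrow> complex^'m^'n" where
  "outer v u = (\<chi> i j. v $ i * cnj (u $ j))"

lemma outer_nth [simp]: "outer v u $ i $ j = v $ i * cnj (u $ j)"
  by (simp add: outer_def)

lemma outer_mult_vec: "outer v u *v x = cinner u x *s v"
  by (simp add: vec_eq_iff matrix_vector_mult_def cinner_def sum_distrib_left sum_distrib_right mult_ac)

lemma outer_smult_left: "outer (c *s v) u = outer v (cnj c *s u)"
  by (simp add: vec_eq_iff)

lemma outer_sum_right: "outer v (\<Sum>k\<in>S. u k) = (\<Sum>k\<in>S. outer v (u k))"
  by (simp add: vec_eq_iff sum_distrib_left)

lemma mult_outer: "X ** outer v u = outer (X *v v) u"
  by (simp add: matrix_eq outer_mult_vec vector_scalar_commute flip: matrix_vector_mul_assoc)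

lemma outer_mult: "outer v u ** X = outer v (ctranspose X *v u)"
  by (simp add: matrix_eq outer_mult_vec cinner_mult_left ctranspose_def flip: matrix_vector_mul_assoc)

text \<open>Evaluating the zero matrix at an arbitrary \<open>x\<close> gives a vanishing
  combination of \<open>B\<close>, so each of its coefficients vanishes by independence. As
  \<open>x\<close> varies, this makes the combination of the \<open>b'\<close> with coefficients
  \<open>cnj (c b b')\<close> orthogonal to everything, hence zero, and independence applies a
  second time.\<close>

lemma outer_coeffs_eq_0:
  fixes B :: "(complex^'n) set"
  assumes B: "vec.independent B" "finite B"
    and 0: "(\<Sum>b\<in>B. \<Sum>b'\<in>B. outer (c b b' *s b) b') = 0"
    and "b \<in> B" "b' \<in> B"
  shows "c b b' = 0"
proof -
  have "cinner (\<Sum>b'\<in>B. cnj (c b b') *s b') x = 0" for x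
  proof -
    have "(\<Sum>b\<in>B. (\<Sum>b'\<in>B. c b b' * cinner b' x) *s b) = (\<Sum>b\<in>B. \<Sum>b'\<in>B. outer (c b b' *s b) b') *v x"
      by (simp add: matrix_vector_mult_sum_left outer_mult_vec vec.scale_sum_left mult.commute)
    then have "(\<Sum>b\<in>B. (\<Sum>b'\<in>B. c b b' * cinner b' x) *s b) = 0"
      by (simp add: 0)
    then have "(\<Sum>b'\<in>B. c b b' * cinner b' x) = 0"
      using vec.independentD[OF B order_refl _ \<open>b \<in> B\<close>] by fastforce
    moreover have "cinner (\<Sum>b'\<in>S. cnj (c b b') *s b') x = (\<Sum>b'\<in>S. c b b' * cinner b' x)" for S
      by (induction S rule: infinite_finite_induct)
        (simp_all add: cinner_add_left cinner_scale_left, simp_all add: cinner_def)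
    ultimately show ?thesis by simp
  qed
  then have "inner (\<Sum>b'\<in>B. cnj (c b b') *s b') x = 0" for x
    by (metis Re_cinner zero_complex.simps(1))
  then have "(\<Sum>b'\<in>B. cnj (c b b') *s b') = 0"
    by (metis inner_eq_zero_iff)
  then show ?thesis
    using vec.independentD[OF B order_refl _ \<open>b' \<in> B\<close>] by fastforce
qed

section \<open>Hermitian matrices on a subspace and their real dimension\<close>

lemma orth_proj:
  assumes "vec.subspace K"
  shows "projection (orth_proj K)" "range ((*v) (orth_proj K)) = K"
  using theI'[OF orth_proj_ex1[OF assms]] by (auto simp: orth_proj_def)

lemma projection_fix: "projection Q \<Longrightarrow> x \<in> range ((*v) Q) \<Longrightarrow> Q *v x = x"
  by (auto simp: projection_def matrix_vector_mul_assoc)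

text \<open>For a projection \<open>Q\<close> this is the space of all \<open>Q ** A ** Q\<close>
  with \<open>A\<close> self-adjoint; in the fixed-point form, membership needs no witness
  \<open>A\<close>.\<close>

definition herm_on :: "complex^'n^'n \<Rightarrow> (complex^'n^'n) set" where
  "herm_on Q = {X. selfadjoint X \<and> Q ** X ** Q = X}"

lemma subspace_herm_on: "subspace (herm_on Q)"
  unfolding subspace_def herm_on_def
  by (auto simp: selfadjoint_add selfadjoint_scaleR matrix_add_ldistrib matrix_mul_add_left
      scalar_matrix_assoc[symmetric] matrix_scalar_ac)
    (simp_all add: selfadjoint_def vec_eq_iff matrix_matrix_mult_def)

lemma range_herm_on:
  assumes Q: "projection Q" and X: "\<And>x. X *v x \<in> range ((*v) Q)" "selfadjoint X"
  shows "X \<in> herm_on Q"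
proof -
  have "Q *v (X *v x) = X *v x" for x
    using projection_fix[OF Q X(1)] .
  then have 1: "Q ** X = X"
    by (simp add: matrix_eq flip: matrix_vector_mul_assoc)
  have "X ** Q = ctranspose (Q ** X)"
    using Q X(2) by (simp add: ctranspose_mult projection_def selfadjoint_def)
  also have "\<dots> = X"
    using X(2) by (simp only: 1 selfadjoint_def)
  finally show ?thesis using 1 X(2) by (simp add: herm_on_def)
qed

text \<open>The columns of \<open>X\<close> lie in the range of \<open>Q\<close>, so expanding them
  in \<open>B\<close> gives a sum of \<open>outer b (u b)\<close>. Multiplying by \<open>Q\<close>
  on the right replaces \<open>u b\<close> by \<open>Q *v u b\<close>, which can be expanded in
  \<open>B\<close> as well.\<close>

lemma herm_on_outer_expansion:
  assumes Q: "projection Q" and B: "finite B" "range ((*v) Q) \<subseteq> vec.span B" and X: "Q ** X ** Q = X"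
  shows "\<exists>c. X = (\<Sum>b\<in>B. \<Sum>b'\<in>B. outer (c b b' *s b) b')"
proof -
  have QQ: "Q ** Q = Q" using Q by (simp add: projection_def)
  have "Q ** (Q ** X ** Q) = Q ** X ** Q"
    by (simp only: matrix_mul_assoc QQ)
  then have QX1: "Q ** X = X" by (simp only: X)
  have "Q ** X ** Q ** Q = Q ** X ** Q"
    by (simp only: matrix_mul_assoc[symmetric] QQ)
  then have QX2: "X ** Q = X" by (simp only: X)
  have "\<exists>a. Q *v x = (\<Sum>b\<in>B. a b *s b)" for x
    using B vec.span_finite[of B] by blast
  then obtain a where a: "\<And>x. Q *v x = (\<Sum>b\<in>B. a x b *s b)" by metis
  define u where "u b = (\<chi> j. cnj (a (column j X) b))" for b
  have "X = (\<Sum>b\<in>B. outer b (u b))"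
  proof -
    have "column j X = (\<Sum>b\<in>B. a (column j X) b *s b)" for j
    proof -
      have "Q *v column j X = column j X"
        by (simp only: column_eq_mult_axis matrix_vector_mul_assoc QX1)
      then show ?thesis using a[of "column j X"] by simp
    qed
    then have "column j X $ i = (\<Sum>b\<in>B. a (column j X) b * b $ i)" for i j
      using arg_cong[of _ _ "\<lambda>x. x $ i"] by fastforce
    moreover have "X $ i $ j = column j X $ i" for i j
      by (simp add: column_def)
    moreover have "(\<Sum>b\<in>B. outer b (u b)) $ i $ j = (\<Sum>b\<in>B. a (column j X) b * b $ i)" for i j
      by (simp add: u_def mult.commute)
    ultimately show ?thesis unfolding vec_eq_iff by presburger
  qed
  then have "X = (\<Sum>b\<in>B. outer b (u b)) ** Q"
    using QX2 by simp
  also have "\<dots> = (\<Sum>b\<in>B. outer b (Q *v u b))"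
    using Q by (simp add: matrix_mul_sum_left outer_mult projection_def selfadjoint_def)
  also have "\<dots> = (\<Sum>b\<in>B. \<Sum>b'\<in>B. outer (cnj (a (u b) b') *s b) b')"
    by (simp add: a outer_sum_right outer_smult_left)
  finally show ?thesis by (rule exI[of _ "\<lambda>b b'. cnj (a (u b) b')"])
qed

lemma dim_herm_on:
  assumes K: "vec.subspace (K :: (complex^'n) set)"
  shows "dim (herm_on (orth_proj K)) = (vec.dim K)\<^sup>2"
proof -
  define Q where "Q = orth_proj K"
  have Q: "projection Q" "range ((*v) Q) = K"
    using orth_proj[OF K] by (auto simp: Q_def)
  obtain B where B: "B \<subseteq> K" "vec.independent B" "K \<subseteq> vec.span B" "card B = vec.dim K"
    by (rule vec.basis_exists)
  have fin: "finite B" using B(2) vec.finiteI_independent by blast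
  \<comment> \<open>\<open>G (b, b')\<close> and \<open>G (b', b)\<close> have sum \<open>b b'\<^sup>* + b' b\<^sup>*\<close> and difference \<open>i (b b'\<^sup>* - b' b\<^sup>*)\<close>; indexing
    by ordered pairs avoids choosing an order on \<open>B\<close>, and \<open>B\<close> need not be orthonormal.\<close>
  define G where "G = (\<lambda>(b :: complex^'n, b' :: complex^'n). outer (((1 + \<i>) / 2) *s b) b' + outer (((1 - \<i>) / 2) *s b') b)"
  have QB: "Q *v b = b" if "b \<in> B" for b
    using projection_fix[OF Q(1)] Q(2) B(1) that by blast
  have sa: "ctranspose Q = Q" using Q by (simp add: projection_def selfadjoint_def)
  have GH: "G ` (B \<times> B) \<subseteq> herm_on Q"
    by (auto simp: G_def herm_on_def matrix_add_ldistrib matrix_mul_add_left mult_outer outer_mult QB sa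
        vector_scalar_commute)
      (simp add: selfadjoint_def vec_eq_iff algebra_simps)
  have coeff0: "t p = 0" if zero: "(\<Sum>p\<in>B \<times> B. t p *\<^sub>R G p) = 0" and mem: "p \<in> B \<times> B" for t p
  proof -
    \<comment> \<open>The coefficient of \<open>outer b b'\<close> once both halves of every
      \<open>G\<close> are collected; the second half enters through the swapped pair.\<close>
    define c where "c b b' = t (b, b') * ((1 + \<i>) / 2) + t (b', b) * ((1 - \<i>) / 2)" for b b'
    have "(\<Sum>p\<in>B \<times> B. t p *\<^sub>R G p)
      = (\<Sum>b\<in>B. \<Sum>b'\<in>B. outer ((t (b, b') * ((1 + \<i>) / 2)) *s b) b')
      + (\<Sum>b\<in>B. \<Sum>b'\<in>B. outer ((t (b, b') * ((1 - \<i>) / 2)) *s b') b)"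
      by (simp add: sum.cartesian_product G_def flip: sum.distrib)
        (intro sum.cong refl, auto simp: vec_eq_iff scaleR_conv_of_real[where ?'a=complex] algebra_simps)
    also have "(\<Sum>b\<in>B. \<Sum>b'\<in>B. outer ((t (b, b') * ((1 - \<i>) / 2)) *s b') b)
      = (\<Sum>b\<in>B. \<Sum>b'\<in>B. outer ((t (b', b) * ((1 - \<i>) / 2)) *s b) b')"
      by (rule sum.swap)
    also have "(\<Sum>b\<in>B. \<Sum>b'\<in>B. outer ((t (b, b') * ((1 + \<i>) / 2)) *s b) b') + \<dots>
      = (\<Sum>b\<in>B. \<Sum>b'\<in>B. outer (c b b' *s b) b')"
      unfolding sum.distrib[symmetric] c_def
      by (intro sum.cong refl) (simp add: vec_eq_iff algebra_simps)
    finally have "(\<Sum>b\<in>B. \<Sum>b'\<in>B. outer (c b b' *s b) b') = 0"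
      using zero by simp
    moreover obtain b b' where p: "p = (b, b')" "b \<in> B" "b' \<in> B" using mem by auto
    ultimately have "c b b' = 0"
      using outer_coeffs_eq_0[OF B(2) fin] by blast
    \<comment> \<open>Real and imaginary part are the half sum and half difference of
      \<open>t (b, b')\<close> and \<open>t (b', b)\<close>, so both of these real numbers
      vanish.\<close>
    then have "Re (c b b') = 0" "Im (c b b') = 0" by simp_all
    then have "t (b, b') / 2 + t (b', b) / 2 = 0" "t (b, b') / 2 - t (b', b) / 2 = 0"
      by (simp_all add: c_def)
    then show ?thesis unfolding p(1) by linarith
  qed
  have inj: "inj_on G (B \<times> B)"
  proof (rule inj_onI, rule ccontr)
    fix p q assume pq: "p \<in> B \<times> B" "q \<in> B \<times> B" "G p = G q" "p \<noteq> q"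
    \<comment> \<open>These coefficients express \<open>G p - G q\<close>; the one at
      \<open>p\<close> is 1, against \<open>coeff0\<close>.\<close>
    define t :: "_ \<Rightarrow> real" where "t r = (if r = p then 1 else 0) - (if r = q then 1 else 0)" for r
    have "(\<Sum>r\<in>B \<times> B. t r *\<^sub>R G r)
      = (\<Sum>r\<in>B \<times> B. (if r = p then G r else 0)) - (\<Sum>r\<in>B \<times> B. (if r = q then G r else 0))"
      unfolding sum_subtractf[symmetric] by (intro sum.cong refl) (simp add: t_def)
    also have "\<dots> = 0"
      using pq(1,2) fin by (simp only: sum.delta finite_cartesian_product if_True pq(3)) simp
    finally have "(\<Sum>r\<in>B \<times> B. t r *\<^sub>R G r) = 0" .
    from coeff0[OF this pq(1)] pq(4) show False by (simp add: t_def)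
  qed
  have ind: "independent (G ` (B \<times> B))"
    unfolding dependent_finite[OF finite_imageI[OF finite_cartesian_product[OF fin fin]]] sum.reindex[OF inj] o_def
    using coeff0[of "\<lambda>p. u (G p)" for u] by blast
  have span: "herm_on Q \<subseteq> span (G ` (B \<times> B))"
  proof
    fix X assume "X \<in> herm_on Q"
    then have X: "selfadjoint X" "Q ** X ** Q = X" by (auto simp: herm_on_def)
    from herm_on_outer_expansion[OF Q(1) fin _ X(2)] Q(2) B(3)
    obtain c where c: "X = (\<Sum>b\<in>B. \<Sum>b'\<in>B. outer (c b b' *s b) b')" by blast
    \<comment> \<open>Symmetrising makes each term of the expansion Hermitian, hence a real
      combination of two values of \<open>G\<close>.\<close>
    have "X = (1 / 2) *\<^sub>R (X + ctranspose X)"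
      using X(1) by (simp add: selfadjoint_def)
    also have "\<dots> = (\<Sum>b\<in>B. \<Sum>b'\<in>B. (1 / 2) *\<^sub>R (outer (c b b' *s b) b' + outer b' (c b b' *s b)))"
    proof -
      have "ctranspose X = (\<Sum>b\<in>B. \<Sum>b'\<in>B. outer b' (c b b' *s b))"
        unfolding c by (simp add: vec_eq_iff mult_ac)
      then show ?thesis by (simp add: c sum.distrib scaleR_sum_right scaleR_add_right)
    qed
    also have "\<dots> \<in> span (G ` (B \<times> B))"
    proof (intro span_sum)
      fix b b' assume b: "b \<in> B" "b' \<in> B"
      \<comment> \<open>The two real coefficients \<open>s\<close> and \<open>r\<close> solve
        \<open>s * (1 + \<i>) + r * (1 - \<i>) = c b b'\<close>.\<close>
      have "(1 / 2) *\<^sub>R (outer (c b b' *s b) b' + outer b' (c b b' *s b))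
        = ((Re (c b b') + Im (c b b')) / 2) *\<^sub>R G (b, b') + ((Re (c b b') - Im (c b b')) / 2) *\<^sub>R G (b', b)"
        by (simp add: vec_eq_iff G_def complex_eq_iff field_simps)
      also have "\<dots> \<in> span (G ` (B \<times> B))"
        using b by (intro span_add span_scale span_base) auto
      finally show "(1 / 2) *\<^sub>R (outer (c b b' *s b) b' + outer b' (c b b' *s b)) \<in> span (G ` (B \<times> B))" .
    qed
    finally show "X \<in> span (G ` (B \<times> B))" .
  qed
  have "dim (herm_on Q) = card (G ` (B \<times> B))"
    using GH span ind by (intro dim_unique[OF _ _ _ refl])
  also have "\<dots> = (vec.dim K)\<^sup>2"
    using inj by (simp add: card_image card_cartesian_product B(4) power2_eq_square)
  finally show ?thesis by (simp add: Q_def)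
qed

section \<open>Positive semidefinite forms and compactness of the density matrices\<close>

lemma matrix_vector_scaleR: "X *v (t *\<^sub>R z) = t *\<^sub>R (X *v z)" for z :: "complex^'n"
  by (simp add: scaleR_eq_smult vector_scalar_commute)

lemma scaleR_matrix_vector: "(t *\<^sub>R X) *v z = t *\<^sub>R (X *v z)" for z :: "complex^'n"
  by (simp add: vec_eq_iff matrix_vector_mult_def scaleR_sum_right)

lemma linear_matrix_vector: "linear ((*v) X)" for X :: "complex^'n^'m"
  by (rule linearI) (simp_all add: matrix_vector_right_distrib matrix_vector_scaleR)

lemma psd_iff_inner: "psd X \<longleftrightarrow> selfadjoint X \<and> (\<forall>x. 0 \<le> inner x (X *v x))"
  by (simp add: psd_def Re_cinner)

lemma projection_psd: "projection P \<Longrightarrow> psd P"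
proof -
  assume P: "projection P"
  have "inner x (P *v x) = inner (P *v x) (P *v x)" for x
    using P selfadjoint_inner[of P x "P *v x"] by (simp add: projection_def matrix_vector_mul_assoc)
  then show ?thesis using P by (simp add: psd_iff_inner projection_def)
qed

text \<open>A weak Cauchy-Schwarz inequality, read off from the form at \<open>x + y\<close> and at
  \<open>x - y\<close>.\<close>

lemma psd_abs_inner_le:
  assumes "psd X"
  shows "2 * \<bar>inner x (X *v y)\<bar> \<le> inner x (X *v x) + inner y (X *v y)"
proof -
  have sym: "inner y (X *v x) = inner x (X *v y)"
    using assms by (metis inner_commute psd_iff_inner selfadjoint_inner)
  have "0 \<le> inner (x + y) (X *v (x + y))" "0 \<le> inner (x - y) (X *v (x - y))"
    using assms by (auto simp: psd_iff_inner)
  then show ?thesis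
    by (simp add: matrix_vector_right_distrib matrix_vector_mult_diff_distrib
        inner_add_left inner_add_right inner_diff_left inner_diff_right sym)
qed

text \<open>Put \<open>y = t *\<^sub>R (X *v x)\<close> into the weak Cauchy-Schwarz inequality: the
  left side is linear in \<open>t\<close> and the right side quadratic, so a small \<open>t\<close>
  forces \<open>X *v x\<close> to vanish.\<close>

lemma psd_inner_eq_0:
  assumes "psd X" "inner x (X *v x) = 0"
  shows "X *v x = 0"
proof -
  define z where "z = X *v x"
  define a where "a = inner z z"
  define b where "b = inner z (X *v z)"
  have b: "0 \<le> b" using assms by (simp add: b_def psd_iff_inner)
  have a: "0 \<le> a" by (simp add: a_def)
  have "inner x (X *v z) = a"
    using assms(1) by (metis a_def psd_iff_inner selfadjoint_inner z_def)
  then have *: "2 * \<bar>t * a\<bar> \<le> t * (t * b)" for t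
    using psd_abs_inner_le[OF assms(1), of x "t *\<^sub>R z"] assms(2)
    by (simp add: matrix_vector_scaleR b_def)
  have "a = 0"
  proof (rule ccontr)
    assume "a \<noteq> 0"
    then have a: "0 < a" using a by simp
    \<comment> \<open>The summand 1 keeps the denominator positive when \<open>b = 0\<close>; then
      \<open>t * b \<le> a < 2 * a\<close>.\<close>
    define t where "t = a / (b + 1)"
    have t: "0 < t" "t * b \<le> a" using a b by (auto simp: t_def field_simps)
    have "t * (2 * a) \<le> t * (t * b)"
      using *[of t] t(1) a by (simp add: abs_mult)
    then have "2 * a \<le> t * b" using t(1) by simp
    then show False using t(2) a by simp
  qed
  then show ?thesis by (simp add: a_def z_def)
qed

lemma cinner_scale_right: "cinner x (c *s y) = c * cinner x y"
  by (simp add: cinner_def sum_distrib_left mult_ac)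

text \<open>Diagonal entries are nonnegative with sum 1. The weak Cauchy-Schwarz inequality at
  \<open>axis i 1\<close> and \<open>axis j 1\<close> bounds the real part of an entry; replacing
  the second vector by \<open>axis j \<i>\<close> bounds the imaginary part.\<close>

lemma density_matrix_entry_bound:
  fixes D :: "complex^'n^'n"
  assumes "density_matrix D"
  shows "norm (D $ i $ j) \<le> 2"
proof -
  have D: "psd D" "trace D = 1" using assms by (auto simp: density_matrix_def)
  have re: "inner (axis i 1) (D *v axis j 1) = Re (D $ i $ j)" for i j
    using cinner_axis[of i D j] by (simp flip: Re_cinner)
  have ax: "axis j \<i> = \<i> *s axis j (1::complex)" for j :: 'n
    by (simp add: vec_eq_iff axis_def)
  have im: "inner (axis i 1) (D *v axis j \<i>) = - Im (D $ i $ j)" for i j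
    unfolding ax vector_scalar_commute Re_cinner[symmetric] cinner_scale_right
    by (simp add: cinner_axis)
  have im': "inner (axis j \<i>) (D *v axis j \<i>) = Re (D $ j $ j)" for j
  proof -
    have "cinner (axis j \<i>) (D *v axis j \<i>) = cnj \<i> * (\<i> * cinner (axis j 1) (D *v axis j 1))"
      unfolding ax vector_scalar_commute cinner_scale_left cinner_scale_right by (rule mult.left_commute)
    then show ?thesis by (simp add: cinner_axis flip: Re_cinner)
  qed
  have ge: "0 \<le> Re (D $ k $ k)" for k
    using D(1) by (metis psd_iff_inner re)
  have "Re (D $ k $ k) \<le> Re (trace D)" for k
    unfolding trace_def Re_sum by (rule member_le_sum) (auto simp: ge)
  then have le: "Re (D $ k $ k) \<le> 1" for k by (simp add: D(2))
  have "\<bar>Re (D $ i $ j)\<bar> \<le> 1"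
    using psd_abs_inner_le[OF D(1), of "axis i 1" "axis j 1"] le[of i] le[of j] by (simp add: re)
  moreover have "\<bar>Im (D $ i $ j)\<bar> \<le> 1"
    using psd_abs_inner_le[OF D(1), of "axis i 1" "axis j \<i>"] le[of i] le[of j] by (simp add: re im im')
  ultimately show ?thesis using cmod_le[of "D $ i $ j"] by linarith
qed

lemma compact_density_matrices: "compact {D :: complex^'n^'n. density_matrix D}"
proof -
  have "norm D \<le> (\<Sum>i\<in>(UNIV :: 'n set). \<Sum>j\<in>(UNIV :: 'n set). 2)" if "density_matrix D" for D :: "complex^'n^'n"
  proof -
    have "norm D \<le> (\<Sum>i\<in>UNIV. norm (D $ i))"
      unfolding norm_vec_def[of D] by (rule L2_set_le_sum) simp
    also have "\<dots> \<le> (\<Sum>i\<in>UNIV. \<Sum>j\<in>UNIV. norm (D $ i $ j))"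
      by (intro sum_mono) (simp add: norm_vec_def[of "D $ _"] L2_set_le_sum)
    also have "\<dots> \<le> (\<Sum>i\<in>(UNIV :: 'n set). \<Sum>j\<in>(UNIV :: 'n set). 2)"
      by (intro sum_mono density_matrix_entry_bound that)
    finally show ?thesis .
  qed
  then have "bounded {D :: complex^'n^'n. density_matrix D}"
    by (auto simp: bounded_iff)
  moreover have "closed {D :: complex^'n^'n. density_matrix D}"
    unfolding density_matrix_def psd_iff_inner selfadjoint_def vec_eq_iff ctranspose_nth
      trace_def matrix_vector_mult_def
    by (intro closed_Collect_conj closed_Collect_all closed_Collect_eq closed_Collect_le continuous_intros)
  ultimately show ?thesis by (simp add: compact_eq_bounded_closed)
qed

lemma convex_density_matrices: "convex {D :: complex^'n^'n. density_matrix D}"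
  by (rule convexI)
    (auto simp: density_matrix_def psd_iff_inner selfadjoint_add selfadjoint_scaleR
      matrix_vector_mult_add_rdistrib scaleR_matrix_vector inner_add_right trace_add trace_scaleR
      scaleR_conv_of_real[where ?'a=complex] simp flip: of_real_add)

section \<open>Rank-one matrices and projections\<close>

lemma trace_outer: "trace (outer v u) = cinner u v"
  by (simp add: trace_def cinner_def mult.commute)

lemma outer_mult_outer: "outer v u ** outer v u = outer (cinner u v *s v) u"
  by (simp add: mult_outer outer_mult_vec)

lemma outer_if_range_dim_le_1:
  fixes X :: "complex^'n^'m"
  assumes "vec.dim (range ((*v) X)) \<le> 1"
  shows "\<exists>v u. X = outer v u"
proof -
  obtain B where B: "vec.independent B" "range ((*v) X) \<subseteq> vec.span B" "card B = vec.dim (range ((*v) X))"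
    by (rule vec.basis_exists)
  have "finite B" using B(1) vec.finiteI_independent by blast
  moreover have "card B \<le> Suc 0" using assms B(3) by simp
  ultimately have "b = b'" if "b \<in> B" "b' \<in> B" for b b'
    using card_le_Suc0_iff_eq[of B] that by simp
  \<comment> \<open>This covers an empty \<open>B\<close> too, where the chosen vector is
    arbitrary.\<close>
  then have "B \<subseteq> {SOME b. b \<in> B}"
    by (metis insert_iff someI subsetI)
  then obtain v where v: "B \<subseteq> {v}" by (rule that)
  have "X *v x \<in> vec.span {v}" for x
    using subsetD[OF vec.span_mono[OF v] subsetD[OF B(2) rangeI]] .
  then have "\<exists>a. X *v x = a *s v" for x
    by (auto simp: vec.span_singleton)
  then obtain a where a: "\<And>x. X *v x = a x *s v" by metis
  have "X $ i $ j = outer v (\<chi> j. cnj (a (axis j 1))) $ i $ j" for i j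
    using a[of "axis j 1"] unfolding column_eq_mult_axis[symmetric]
    by (simp add: vec_eq_iff column_def mult.commute)
  then show ?thesis by (metis vec_eq_iff)
qed

text \<open>\<open>rank\<close> unfolds to the dimension of the row space, so the argument runs
  through the rows instead of the range.\<close>

lemma rank_one_imp_outer:
  fixes X :: "complex^'n^'m"
  assumes "rank X = 1"
  shows "\<exists>v u. X = outer v u"
proof -
  obtain B where B: "rows X \<subseteq> vec.span B" "card B = vec.dim (rows X)"
    by (rule vec.basis_exists)
  then have "card B = 1" using assms by (simp add: row_rank_def_gen)
  then obtain u where "B = {u}" by (rule card_1_singletonE)
  then have "row i X \<in> vec.span {u}" for i
    using B(1) by (auto simp: rows_def)
  then have "\<exists>a. row i X = a *s u" for i
    by (auto simp: vec.span_singleton)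
  then obtain a where a: "\<And>i. row i X = a i *s u" by metis
  have "X $ i $ j = outer (\<chi> i. a i) (\<chi> j. cnj (u $ j)) $ i $ j" for i j
    using a[of i] by (simp add: vec_eq_iff row_def)
  then show ?thesis by (metis vec_eq_iff)
qed

lemma rank_outer:
  fixes v :: "complex^'m" and u :: "complex^'n"
  assumes "outer v u \<noteq> 0"
  shows "rank (outer v u) = 1"
proof -
  have "row i (outer v u) = v $ i *s (\<chi> j. cnj (u $ j))" for i
    by (simp add: vec_eq_iff row_def)
  then have "rows (outer v u) \<subseteq> vec.span {\<chi> j. cnj (u $ j)}"
    by (auto simp: rows_def vec.span_singleton)
  from vec.dim_le_card[OF this] have "rank (outer v u) \<le> 1"
    by (simp add: row_rank_def_gen)
  moreover have "\<not> rows (outer v u) \<subseteq> {0}"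
  proof
    assume "rows (outer v u) \<subseteq> {0}"
    then have "row i (outer v u) = 0" for i by (auto simp: rows_def)
    then have "outer v u = 0" by (simp add: vec_eq_iff row_def)
    with assms show False by simp
  qed
  then have "rank (outer v u) \<noteq> 0"
    unfolding row_rank_def_gen by (simp add: vec.dim_eq_0)
  ultimately show ?thesis by simp
qed

text \<open>For \<open>P = outer v u\<close> the square is \<open>cinner u v\<close> times
  \<open>P\<close>, so idempotence and a nonzero entry give \<open>cinner u v = 1\<close>, which is
  the trace.\<close>

lemma rank_one_projection_trace:
  assumes "projection P" "rank P = 1"
  shows "trace P = 1"
proof -
  obtain v u where P: "P = outer v u" using rank_one_imp_outer assms(2) by blast
  have "P \<noteq> 0"
  proof
    assume "P = 0"
    then have "rows P \<subseteq> {0}" by (auto simp: rows_def row_def vec_eq_iff)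
    then show False using assms(2) by (simp add: row_rank_def_gen flip: vec.dim_eq_0)
  qed
  then obtain i j where ij: "v $ i * cnj (u $ j) \<noteq> 0" by (auto simp: P vec_eq_iff)
  have "outer (cinner u v *s v) u = outer v u"
    using assms(1) by (simp add: P projection_def outer_mult_outer)
  from arg_cong[OF this, of "\<lambda>X. X $ i $ j"]
  have "cinner u v * (v $ i * cnj (u $ j)) = v $ i * cnj (u $ j)"
    by (simp add: mult.assoc)
  then show ?thesis using ij by (simp add: P trace_outer)
qed

text \<open>Conversely, trace 1 means \<open>cinner u v = 1\<close>, which makes
  \<open>outer v u\<close> idempotent.\<close>

lemma rank_one_density_projection:
  assumes D: "density_matrix D" and dim: "vec.dim (range ((*v) D)) \<le> 1"
  shows "projection D" "rank D = 1"
proof -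
  obtain v u where vu: "D = outer v u" using outer_if_range_dim_le_1[OF dim] by blast
  have "selfadjoint D" "trace D = 1" using D by (auto simp: density_matrix_def psd_def)
  then show "projection D"
    by (simp add: projection_def vu outer_mult_outer trace_outer)
  have "D \<noteq> 0" using \<open>trace D = 1\<close> by (auto simp: trace_def)
  then show "rank D = 1" using rank_outer vu by blast
qed

section \<open>Perturbation inside the range, and compressions\<close>

lemma herm_on_inner_mult:
  assumes "X \<in> herm_on Q" "projection Q"
  shows "inner x (X *v x) = inner (Q *v x) (X *v (Q *v x))"
proof -
  have "inner x (X *v x) = inner x (Q *v (X *v (Q *v x)))"
    using assms(1) by (simp add: herm_on_def matrix_vector_mul_assoc matrix_mul_assoc)
  also have "\<dots> = inner (Q *v x) (X *v (Q *v x))"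
    using assms(2) by (simp add: projection_def selfadjoint_inner)
  finally show ?thesis .
qed

text \<open>The range is orthogonal to the kernel, so the form is positive at nonzero vectors of the
  range. Its minimum over the compact unit sphere of the range is therefore positive, and scaling
  gives the bound elsewhere.\<close>

lemma psd_lower_bound_on_range:
  fixes X :: "complex^'n^'n"
  assumes "psd X"
  shows "\<exists>m>0. \<forall>x\<in>range ((*v) X). m * (norm x)\<^sup>2 \<le> inner x (X *v x)"
proof -
  define S where "S = range ((*v) X) \<inter> sphere 0 1"
  have sub: "subspace (range ((*v) X))"
    using linear_subspace_image[OF linear_matrix_vector subspace_UNIV] .
  have "compact S"
    unfolding S_def by (simp add: closed_Int_compact closed_subspace sub)
  show ?thesis
  proof (cases "S = {}")
    \<comment> \<open>Here the range is zero, so any positive constant works.\<close>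
    case True
    have "x = 0" if "x \<in> range ((*v) X)" for x
    proof (rule ccontr)
      assume "x \<noteq> 0"
      then have "(1 / norm x) *\<^sub>R x \<in> S"
        using that subspace_scale[OF sub] by (auto simp: S_def)
      with True show False by simp
    qed
    then have "1 * (norm x)\<^sup>2 \<le> inner x (X *v x)" if "x \<in> range ((*v) X)" for x
      using that by fastforce
    then show ?thesis using zero_less_one by blast
  next
    case False
    have "continuous_on S (\<lambda>x. inner x (X *v x))"
      unfolding matrix_vector_mult_def by (intro continuous_intros)
    then obtain x0 where x0: "x0 \<in> S" "\<And>x. x \<in> S \<Longrightarrow> inner x0 (X *v x0) \<le> inner x (X *v x)"
      using continuous_attains_inf[OF \<open>compact S\<close> False] by blast
    have "inner x0 (X *v x0) \<noteq> 0"
    proof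
      assume "inner x0 (X *v x0) = 0"
      then have 0: "X *v x0 = 0" using psd_inner_eq_0 assms by blast
      obtain w where "x0 = X *v w" using x0(1) by (auto simp: S_def)
      then have "inner x0 x0 = inner w (X *v x0)"
        using assms by (metis psd_def selfadjoint_inner)
      then show False using 0 x0(1) by (simp add: S_def)
    qed
    then have pos: "inner x0 (X *v x0) > 0"
      using assms by (metis psd_iff_inner order_le_less)
    have "inner x0 (X *v x0) * (norm x)\<^sup>2 \<le> inner x (X *v x)" if "x \<in> range ((*v) X)" for x
    proof (cases "x = 0")
      case False
      then have "(1 / norm x) *\<^sub>R x \<in> S"
        using that subspace_scale[OF sub] by (auto simp: S_def)
      from x0(2)[OF this] show ?thesis
        using False by (simp add: matrix_vector_scaleR power2_eq_square field_simps)
    qed simp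
    with pos show ?thesis by blast
  qed
qed

text \<open>On the range the form of \<open>X\<close> is at least \<open>m\<close> times the squared
  norm, while that of \<open>H\<close> is at most \<open>C\<close> times it in absolute value; so
  \<open>m / C\<close> serves as the bound on \<open>s\<close>. Other vectors are first projected by
  \<open>Q\<close>.\<close>

lemma psd_perturb:
  fixes X :: "complex^'n^'n"
  assumes X: "psd X" "X \<in> herm_on Q" and Q: "projection Q" "range ((*v) Q) = range ((*v) X)"
    and H: "H \<in> herm_on Q"
  shows "\<exists>\<epsilon>>0. \<forall>s. \<bar>s\<bar> \<le> \<epsilon> \<longrightarrow> psd (X + s *\<^sub>R H)"
proof -
  from psd_lower_bound_on_range[OF X(1)]
  obtain m where m: "0 < m" "\<forall>x\<in>range ((*v) X). m * (norm x)\<^sup>2 \<le> inner x (X *v x)"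
    by (elim exE conjE)
  obtain C where C: "0 < C" "\<And>x. norm (H *v x) \<le> C * norm x"
    by (rule linear_bounded_pos[OF linear_matrix_vector[of H]], rule that) simp_all
  have "psd (X + s *\<^sub>R H)" if s: "\<bar>s\<bar> \<le> m / C" for s
  proof -
    have mem: "X + s *\<^sub>R H \<in> herm_on Q"
      by (intro subspace_add subspace_scale subspace_herm_on X H)
    have nonneg: "0 \<le> inner y ((X + s *\<^sub>R H) *v y)" if y: "y \<in> range ((*v) X)" for y
    proof -
      have "\<bar>inner y (H *v y)\<bar> \<le> norm y * norm (H *v y)"
        by (rule Cauchy_Schwarz_ineq2)
      also have "\<dots> \<le> norm y * (C * norm y)"
        by (rule mult_left_mono[OF C(2) norm_ge_zero])
      finally have "\<bar>s\<bar> * \<bar>inner y (H *v y)\<bar> \<le> (m / C) * (norm y * (C * norm y))"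
        by (rule mult_mono[OF s]) (use m(1) C(1) in simp_all)
      then have "\<bar>s * inner y (H *v y)\<bar> \<le> (m / C) * (norm y * (C * norm y))"
        by (simp only: abs_mult)
      also have "\<dots> = m * (norm y)\<^sup>2" using C by (simp add: power2_eq_square)
      also have "\<dots> \<le> inner y (X *v y)" by (rule bspec[OF m(2) y])
      finally show ?thesis
        by (simp add: matrix_vector_mult_add_rdistrib scaleR_matrix_vector inner_add_right)
    qed
    have "0 \<le> inner x ((X + s *\<^sub>R H) *v x)" for x
      using nonneg[of "Q *v x"] herm_on_inner_mult[OF mem Q(1), of x] Q(2) by (metis rangeI)
    then show ?thesis using mem by (simp add: psd_iff_inner herm_on_def)
  qed
  then show ?thesis using m(1) C(1) by (intro exI[of _ "m / C"]) auto
qed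

text \<open>By cyclicity of the trace the two copies of the projection move from \<open>A\<close> to
  \<open>X\<close>, where they are absorbed. Orthogonality to a compression thereby becomes a
  statement about the original observable.\<close>

lemma inner_compress:
  assumes "vec.subspace K" "X \<in> herm_on (orth_proj K)" "selfadjoint A"
  shows "inner X (compress K A) = inner X A"
proof -
  define Q where "Q = orth_proj K"
  have Q: "projection Q" using orth_proj assms(1) by (simp add: Q_def)
  then have sa: "selfadjoint (Q ** A ** Q)" using assms(3) by (simp add: projection_def selfadjoint_conj)
  have X: "selfadjoint X" "Q ** X ** Q = X" using assms(2) by (auto simp: herm_on_def Q_def)
  have "complex_of_real (inner X (Q ** A ** Q)) = trace (X ** (Q ** A ** Q))"
    using trace_selfadjoint_mult[OF X(1) sa] ..
  also have "\<dots> = trace ((Q ** X ** Q) ** A)"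
    using trace_mul_sym[of "X ** (Q ** A)" Q] by (simp add: matrix_mul_assoc)
  also have "\<dots> = complex_of_real (inner X A)"
    unfolding X(2) by (rule trace_selfadjoint_mult[OF X(1) assms(3)])
  finally show ?thesis by (simp add: compress_def Q_def)
qed

lemma compress_in_herm_on:
  assumes "vec.subspace K" "selfadjoint A"
  shows "compress K A \<in> herm_on (orth_proj K)"
proof -
  define Q where "Q = orth_proj K"
  have Q: "selfadjoint Q" "Q ** Q = Q" using orth_proj assms(1) by (auto simp: Q_def projection_def)
  have "Q ** (Q ** A ** Q) ** Q = (Q ** Q) ** A ** (Q ** Q)" by (simp only: matrix_mul_assoc)
  also have "\<dots> = Q ** A ** Q" by (simp only: Q(2))
  finally show ?thesis
    unfolding herm_on_def compress_def Q_def[symmetric]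
    using selfadjoint_conj[OF Q(1) assms(2)] by blast
qed

section \<open>Decompositions that preserve the variance\<close>

lemma weighted_variance_eq_0:
  fixes c a :: "'k \<Rightarrow> real"
  assumes "finite S" "\<And>k. k \<in> S \<Longrightarrow> 0 \<le> c k" "sum c S = 1"
    and mean: "(\<Sum>k\<in>S. c k * a k) = \<mu>" and sq: "(\<Sum>k\<in>S. c k * (a k * a k)) = \<mu> * \<mu>"
    and k: "k \<in> S" "0 < c k"
  shows "a k = \<mu>"
proof -
  have "(\<Sum>k\<in>S. c k * (a k - \<mu>)\<^sup>2)
    = (\<Sum>k\<in>S. c k * (a k * a k)) - 2 * \<mu> * (\<Sum>k\<in>S. c k * a k) + \<mu> * \<mu> * (\<Sum>k\<in>S. c k)"
    unfolding sum_distrib_left sum_subtractf[symmetric] sum.distrib[symmetric]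
    by (intro sum.cong refl) (simp add: power2_eq_square algebra_simps)
  then have "(\<Sum>k\<in>S. c k * (a k - \<mu>)\<^sup>2) = 0"
    by (simp add: mean sq assms(3))
  then have "c k * (a k - \<mu>)\<^sup>2 = 0"
    using sum_nonneg_eq_0_iff[of S "\<lambda>k. c k * (a k - \<mu>)\<^sup>2"] assms(1,2) k(1) by simp
  then show ?thesis using k(2) by simp
qed

lemma Var_nth:
  assumes "selfadjoint D" "\<And>i. selfadjoint (A i)"
  shows "Var D A $ i $ j = trace (D ** A i ** A j) - of_real (inner D (A i) * inner D (A j))"
  by (simp add: Var_def trace_selfadjoint_mult assms)

text \<open>The terms \<open>trace (D ** A i ** A j)\<close> are linear in \<open>D\<close> and
  cancel, which leaves an identity between products of expectations. Its diagonal entries say that a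
  weighted variance vanishes; the converse is substitution.\<close>

lemma Var_decomposition_iff:
  fixes A :: "'r::finite \<Rightarrow> complex^'n^'n" and m :: nat
  assumes A: "\<And>i. selfadjoint (A i)" and P: "\<And>k. k < m \<Longrightarrow> selfadjoint (P k)"
    and c: "\<And>k. k < m \<Longrightarrow> 0 \<le> c k" "(\<Sum>k<m. c k) = 1"
    and D: "D = (\<Sum>k<m. c k *\<^sub>R P k)"
  shows "Var D A = (\<Sum>k<m. c k *\<^sub>R Var (P k) A)
    \<longleftrightarrow> (\<forall>k<m. 0 < c k \<longrightarrow> (\<forall>i. inner (P k) (A i) = inner D (A i)))"
proof -
  have saD: "selfadjoint D"
    unfolding D selfadjoint_def vec_eq_iff
    using P by (simp add: selfadjoint_nth)
  have tr: "trace (D ** A i ** A j) = (\<Sum>k<m. c k *\<^sub>R trace (P k ** A i ** A j))" for i j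
    by (simp add: D matrix_mul_sum_left scalar_matrix_assoc[symmetric] trace_sum trace_scaleR)
  have mean: "inner D (A i) = (\<Sum>k<m. c k * inner (P k) (A i))" for i
    by (simp add: D inner_sum_left)
  have "(\<Sum>k<m. c k *\<^sub>R Var (P k) A) $ i $ j
    = (\<Sum>k<m. c k *\<^sub>R trace (P k ** A i ** A j))
      - of_real (\<Sum>k<m. c k * (inner (P k) (A i) * inner (P k) (A j)))" for i j
    unfolding of_real_sum sum_subtractf[symmetric] sum_component
    by (intro sum.cong refl) (simp add: Var_nth A P scaleR_conv_of_real[where ?'a=complex] algebra_simps)
  then have iff: "Var D A = (\<Sum>k<m. c k *\<^sub>R Var (P k) A)
    \<longleftrightarrow> (\<forall>i j. inner D (A i) * inner D (A j) = (\<Sum>k<m. c k * (inner (P k) (A i) * inner (P k) (A j))))"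
    by (simp add: vec_eq_iff Var_nth[OF saD A] tr del: sum_component of_real_sum of_real_mult)
  show ?thesis unfolding iff
  proof (intro iffI allI impI)
    fix k i
    assume "\<forall>i j. inner D (A i) * inner D (A j) = (\<Sum>k<m. c k * (inner (P k) (A i) * inner (P k) (A j)))"
      and k: "k < m" "0 < c k"
    then have "(\<Sum>k<m. c k * (inner (P k) (A i) * inner (P k) (A i))) = inner D (A i) * inner D (A i)"
      by metis
    from weighted_variance_eq_0[OF finite_lessThan _ c(2) mean[symmetric] this]
    show "inner (P k) (A i) = inner D (A i)" using c(1) k by simp
  next
    fix i j
    assume eq: "\<forall>k<m. 0 < c k \<longrightarrow> (\<forall>i. inner (P k) (A i) = inner D (A i))"
    have "(\<Sum>k<m. c k * (inner (P k) (A i) * inner (P k) (A j)))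
      = (\<Sum>k<m. c k * (inner D (A i) * inner D (A j)))"
    proof (rule sum.cong[OF refl])
      fix k assume "k \<in> {..<m}"
      then show "c k * (inner (P k) (A i) * inner (P k) (A j)) = c k * (inner D (A i) * inner D (A j))"
        using eq c(1)[of k] by (cases "c k = 0") auto
    qed
    also have "\<dots> = inner D (A i) * inner D (A j)"
      using c(2) by (simp flip: sum_distrib_right)
    finally show "inner D (A i) * inner D (A j) = (\<Sum>k<m. c k * (inner (P k) (A i) * inner (P k) (A j)))" ..
  qed
qed

section \<open>The dimension condition implies decomposability\<close>

lemma subspace_range_matrix: "vec.subspace (range ((*v) X))" for X :: "complex^'n^'m"
  by (rule vec.subspaceI)
    (auto simp: image_iff matrix_vector_right_distrib[symmetric] vector_scalar_commute[symmetric]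
      intro: exI[of _ 0])

lemma extreme_density_range_dim_le_1:
  fixes A :: "'r::finite \<Rightarrow> complex^'n^'n"
  assumes A: "\<And>i. selfadjoint (A i)"
    and small: "\<And>K :: (complex^'n) set. vec.subspace K \<Longrightarrow> 1 < vec.dim K \<Longrightarrow>
       dim (span (insert (compress K (mat 1)) (range (\<lambda>i. compress K (A i))))) < (vec.dim K)\<^sup>2"
    and E: "E extreme_point_of {E. density_matrix E \<and> (\<forall>i. inner E (A i) = a i)}"
  shows "vec.dim (range ((*v) E)) \<le> 1"
proof (rule ccontr)
  assume "\<not> vec.dim (range ((*v) E)) \<le> 1"
  then have dim: "1 < vec.dim (range ((*v) E))" by simp
  define F where "F = {E. density_matrix E \<and> (\<forall>i. inner E (A i) = a i)}"
  have EF: "E \<in> F" using E by (simp add: extreme_point_of_def F_def)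
  define K where "K = range ((*v) E)"
  define Q where "Q = orth_proj K"
  define S where "S = insert (compress K (mat 1)) (range (\<lambda>i. compress K (A i)))"
  have K: "vec.subspace K" by (simp add: K_def subspace_range_matrix)
  have Q: "projection Q" "range ((*v) Q) = K" using orth_proj[OF K] by (simp_all add: Q_def)
  have psdE: "psd E" "selfadjoint E" and trE: "trace E = 1"
    using EF by (auto simp: F_def density_matrix_def psd_def)
  have EQ: "E \<in> herm_on Q"
    using psdE(2) by (intro range_herm_on[OF Q(1)]) (simp_all add: Q(2) K_def)
  have "S \<subseteq> herm_on Q"
    unfolding S_def Q_def using compress_in_herm_on[OF K] A selfadjoint_mat_1 by auto
  then have sub: "span S \<subseteq> herm_on Q"
    using span_minimal subspace_herm_on by blast
  have "dim (span S) < dim (herm_on Q)"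
    using small[OF K] dim dim_herm_on[OF K] by (simp add: S_def Q_def K_def)
  then have "span S \<noteq> herm_on Q" by (metis less_irrefl)
  then have "span S \<subset> span (herm_on Q)"
    using sub by (simp add: psubset_eq span_eq_iff[THEN iffD2, OF subspace_herm_on])
  \<comment> \<open>The dimension gap leaves a nonzero Hermitian direction on \<open>K\<close>
    orthogonal to all the compressions.\<close>
  then obtain H where H: "H \<noteq> 0" "H \<in> span (herm_on Q)" "\<And>Y. Y \<in> span S \<Longrightarrow> orthogonal H Y"
    using orthogonal_to_subspace_exists_gen[of S "herm_on Q"] by metis
  have HQ: "H \<in> herm_on Q"
    using H(2) by (simp add: span_eq_iff[THEN iffD2, OF subspace_herm_on])
  then have saH: "selfadjoint H" by (simp add: herm_on_def)
  have orth: "inner H (compress K B) = 0" if "compress K B \<in> S" for B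
    using H(3)[OF span_base[OF that]] by (simp add: orthogonal_def)
  have HA: "inner H (A i) = 0" for i
    using orth[of "A i"] inner_compress[OF K HQ[unfolded Q_def] A] by (simp add: S_def)
  have "inner H (mat 1) = 0"
    using orth[of "mat 1"] inner_compress[OF K HQ[unfolded Q_def] selfadjoint_mat_1] by (simp add: S_def)
  then have trH: "trace H = 0" using inner_mat_1[OF saH] by simp
  obtain \<epsilon> where \<epsilon>: "0 < \<epsilon>" "\<And>s. \<bar>s\<bar> \<le> \<epsilon> \<Longrightarrow> psd (E + s *\<^sub>R H)"
    using psd_perturb[OF psdE(1) EQ Q(1) _ HQ] Q(2) K_def by blast
  \<comment> \<open>Moving along \<open>H\<close> changes neither the trace nor any expectation, and
    small steps stay positive.\<close>
  have in_F: "E + s *\<^sub>R H \<in> F" if "\<bar>s\<bar> \<le> \<epsilon>" for s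
    using EF \<epsilon>(2)[OF that]
    by (simp add: F_def density_matrix_def trace_add trace_scaleR trH HA inner_add_left)
  have "E = midpoint (E + (- \<epsilon>) *\<^sub>R H) (E + \<epsilon> *\<^sub>R H)"
    by (simp add: midpoint_def flip: scaleR_2)
  moreover have "E + (- \<epsilon>) *\<^sub>R H \<noteq> E + \<epsilon> *\<^sub>R H"
  proof
    assume "E + (- \<epsilon>) *\<^sub>R H = E + \<epsilon> *\<^sub>R H"
    moreover have "(2 * \<epsilon>) *\<^sub>R H = (E + \<epsilon> *\<^sub>R H) - (E + (- \<epsilon>) *\<^sub>R H)"
      unfolding mult_2 scaleR_add_left by simp
    ultimately have "(2 * \<epsilon>) *\<^sub>R H = 0" by simp
    then show False using \<epsilon>(1) H(1) by simp
  qed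
  ultimately have "E \<in> open_segment (E + (- \<epsilon>) *\<^sub>R H) (E + \<epsilon> *\<^sub>R H)"
    by (metis midpoint_in_open_segment)
  moreover have "E + (- \<epsilon>) *\<^sub>R H \<in> F" "E + \<epsilon> *\<^sub>R H \<in> F"
    using in_F[of "- \<epsilon>"] in_F[of \<epsilon>] \<epsilon>(1) by simp_all
  ultimately show False
    using E unfolding extreme_point_of_def F_def by blast
qed

lemma variance_decomposable_if_dim_less:
  fixes A :: "'r::finite \<Rightarrow> complex^'n^'n"
  assumes A: "\<And>i. selfadjoint (A i)"
    and small: "\<And>K :: (complex^'n) set. vec.subspace K \<Longrightarrow> 1 < vec.dim K \<Longrightarrow>
       dim (span (insert (compress K (mat 1)) (range (\<lambda>i. compress K (A i))))) < (vec.dim K)\<^sup>2"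
  shows "variance_decomposable A"
  unfolding variance_decomposable_def
proof (intro allI impI)
  fix D :: "complex^'n^'n" assume D: "density_matrix D"
  define F where "F = {E. density_matrix E \<and> (\<forall>i. inner E (A i) = inner D (A i))}"
  \<comment> \<open>As a slice of the density matrices by hyperplanes, \<open>F\<close> inherits
    compactness and convexity.\<close>
  have F: "F = {E. density_matrix E} \<inter> (\<Inter>i. {E. inner (A i) E = inner D (A i)})"
    by (auto simp: F_def inner_commute)
  have "compact F" unfolding F
    by (intro compact_Int_closed compact_density_matrices closed_INT ballI closed_hyperplane)
  moreover have "convex F" unfolding F
    by (intro convex_Int convex_density_matrices convex_INT ballI convex_hyperplane)
  ultimately have "F = convex hull {E. E extreme_point_of F}"
    by (rule Krein_Milman_Minkowski)
  moreover have "D \<in> F" using D by (simp add: F_def)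
  ultimately have "D \<in> convex hull {E. E extreme_point_of F}" by simp
  then obtain m u X where uX: "\<And>k. k \<in> {1..m::nat} \<Longrightarrow> 0 \<le> u k \<and> X k extreme_point_of F"
    and u1: "sum u {1..m} = 1" and DX: "(\<Sum>k = 1..m. u k *\<^sub>R X k) = D"
    unfolding convex_hull_indexed mem_Collect_eq by metis
  \<comment> \<open>The hull is indexed by \<open>{1..m}\<close>, the decomposition by the numbers
    below \<open>m\<close>.\<close>
  define P c where "P k = X (Suc k)" and "c k = u (Suc k)" for k
  have Pext: "P k extreme_point_of F" and c0: "0 \<le> c k" if "k < m" for k
    using uX[of "Suc k"] that by (auto simp: P_def c_def)
  have PF: "P k \<in> F" if "k < m" for k
    using Pext[OF that] by (simp add: extreme_point_of_def)
  have PP: "projection (P k)" "rank (P k) = 1" if "k < m" for k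
  proof -
    have "vec.dim (range ((*v) (P k))) \<le> 1"
      using extreme_density_range_dim_le_1[OF A small Pext[OF that, unfolded F_def]] .
    then show "projection (P k)" "rank (P k) = 1"
      using rank_one_density_projection PF[OF that] by (auto simp: F_def)
  qed
  have c1: "(\<Sum>k<m. c k) = 1" and Dsum: "D = (\<Sum>k<m. c k *\<^sub>R P k)"
    using u1 DX by (simp_all add: c_def P_def sum.atLeast1_atMost_eq)
  have saP: "selfadjoint (P k)" if "k < m" for k
    using PP(1)[OF that] by (simp add: projection_def)
  have V: "Var D A = (\<Sum>k<m. c k *\<^sub>R Var (P k) A)"
    using Var_decomposition_iff[where P=P, OF A saP c0 c1 Dsum] PF by (simp add: F_def)
  have "\<forall>k<m. projection (P k) \<and> rank (P k) = 1 \<and> 0 \<le> c k"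
    using PP c0 by simp
  show "\<exists>(m::nat) P c. (\<forall>k<m. projection (P k) \<and> rank (P k) = 1 \<and> 0 \<le> c k) \<and> (\<Sum>k<m. c k) = 1 \<and>
      D = (\<Sum>k<m. c k *\<^sub>R P k) \<and> Var D A = (\<Sum>k<m. c k *\<^sub>R Var (P k) A)"
    by (intro exI[of _ m] exI[of _ P] exI[of _ c] conjI) fact+
qed

section \<open>Decomposability implies the dimension condition\<close>

lemma component_in_herm_on:
  fixes P :: "nat \<Rightarrow> complex^'n^'n"
  assumes Q: "projection Q" and P: "\<And>k. k < m \<Longrightarrow> projection (P k)"
    and c: "\<And>k. k < m \<Longrightarrow> 0 \<le> c k" and sum: "(\<Sum>k<m. c k *\<^sub>R P k) = t *\<^sub>R Q"
    and k: "k < m" "0 < c k"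
  shows "P k \<in> herm_on Q"
proof -
  have psdP: "0 \<le> inner x (P k *v x)" if "k < m" for k x
    using projection_psd[OF P[OF that]] by (simp add: psd_iff_inner)
  have QQ: "Q ** Q = Q" "ctranspose Q = Q" using Q by (auto simp: projection_def selfadjoint_def)
  \<comment> \<open>At a vector \<open>y\<close> killed by \<open>Q\<close> the forms of the
    weighted summands are nonnegative with sum 0. So each vanishes, and a summand of positive weight
    kills \<open>y\<close>.\<close>
  have "P k *v (x - Q *v x) = 0" for x
  proof -
    define y where "y = x - Q *v x"
    have "Q *v y = 0"
      by (simp add: y_def matrix_vector_mult_diff_distrib matrix_vector_mul_assoc QQ)
    then have "inner y ((\<Sum>k<m. c k *\<^sub>R P k) *v y) = 0"
      by (simp add: sum scaleR_matrix_vector)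
    then have "(\<Sum>k<m. c k * inner y (P k *v y)) = 0"
      by (simp add: matrix_vector_mult_sum_left scaleR_matrix_vector inner_sum_right)
    then have "c k * inner y (P k *v y) = 0"
      using sum_nonneg_eq_0_iff[of "{..<m}" "\<lambda>k. c k * inner y (P k *v y)"] c psdP k(1) by simp
    then have "inner y (P k *v y) = 0" using k(2) by simp
    then show ?thesis
      using psd_inner_eq_0[OF projection_psd[OF P[OF k(1)]]] by (simp add: y_def)
  qed
  then have "P k *v x = (P k ** Q) *v x" for x
    by (simp add: matrix_vector_mult_diff_distrib flip: matrix_vector_mul_assoc)
  then have PQ: "P k ** Q = P k" by (simp add: matrix_eq)
  have sa: "ctranspose (P k) = P k" using P[OF k(1)] by (simp add: projection_def selfadjoint_def)
  have "Q ** P k = ctranspose (P k ** Q)" by (simp add: ctranspose_mult sa QQ)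
  then have "Q ** P k = P k" by (simp add: PQ sa)
  then show ?thesis using PQ sa by (simp add: herm_on_def selfadjoint_def)
qed

lemma dim_less_if_variance_decomposable:
  fixes A :: "'r::finite \<Rightarrow> complex^'n^'n" and K :: "(complex^'n) set"
  assumes A: "\<And>i. selfadjoint (A i)" and vd: "variance_decomposable A"
    and K: "vec.subspace K" and dimK: "1 < vec.dim K"
  shows "dim (span (insert (compress K (mat 1)) (range (\<lambda>i. compress K (A i))))) < (vec.dim K)\<^sup>2"
proof (rule ccontr)
  define Q where "Q = orth_proj K"
  define S where "S = insert (compress K (mat 1)) (range (\<lambda>i. compress K (A i)))"
  assume "\<not> ?thesis"
  then have ge: "dim (herm_on Q) \<le> dim (span S)"
    using dim_herm_on[OF K] by (simp add: S_def Q_def)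
  have Q: "projection Q" "range ((*v) Q) = K" using orth_proj[OF K] by (simp_all add: Q_def)
  then have saQ: "selfadjoint Q" and QQ: "Q ** Q = Q" by (auto simp: projection_def)
  have "S \<subseteq> herm_on Q"
    unfolding S_def Q_def using compress_in_herm_on[OF K] A selfadjoint_mat_1 by auto
  then have "span S \<subseteq> herm_on Q"
    using span_minimal subspace_herm_on by blast
  \<comment> \<open>If the inequality fails, the compressions span all Hermitian matrices on
    \<open>K\<close>.\<close>
  from subspace_dim_equal[OF subspace_span subspace_herm_on this ge]
  have spanS: "span S = herm_on Q" .
  \<comment> \<open>This is the trace of \<open>Q\<close>, which normalises \<open>Q\<close> to a
    density matrix.\<close>
  define \<tau> where "\<tau> = inner Q Q"
  have trQ: "trace Q = of_real \<tau>"
    using trace_selfadjoint_mult[OF saQ saQ] by (simp add: \<tau>_def QQ)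
  have "Q \<noteq> 0"
  proof
    assume "Q = 0"
    then have "K \<subseteq> {0}" using Q(2) by auto
    then have "vec.dim K \<le> card {0 :: complex^'n}" by (intro vec.dim_le_card) (auto intro: vec.span_base)
    then show False using dimK by simp
  qed
  then have \<tau>: "0 < \<tau>" by (simp add: \<tau>_def)
  define D where "D = (1 / \<tau>) *\<^sub>R Q"
  have "density_matrix D"
    using projection_psd[OF Q(1)] \<tau>
    by (simp add: density_matrix_def psd_iff_inner D_def selfadjoint_scaleR scaleR_matrix_vector
        trace_scaleR trQ scaleR_conv_of_real[where ?'a=complex])
  from mp[OF spec[OF vd[unfolded variance_decomposable_def], of D] this]
  obtain m :: nat and P c where "\<forall>k<m. projection (P k) \<and> rank (P k) = 1 \<and> 0 \<le> c k"
    and c1: "(\<Sum>k<m. c k) = 1" and Dsum: "D = (\<Sum>k<m. c k *\<^sub>R P k)"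
    and V: "Var D A = (\<Sum>k<m. c k *\<^sub>R Var (P k) A)"
    by (elim exE conjE)
  then have Pc: "projection (P k) \<and> rank (P k) = 1 \<and> 0 \<le> c k" if "k < m" for k
    using that by blast
  have "\<exists>k<m. 0 < c k"
  proof (rule ccontr)
    assume "\<not> ?thesis"
    then have "(\<Sum>k<m. c k) \<le> 0" by (metis lessThan_iff not_less sum_nonpos)
    then show False using c1 by simp
  qed
  then obtain k where k: "k < m" "0 < c k" by blast
  have saP: "selfadjoint (P k)" if "k < m" for k using Pc[OF that] by (simp add: projection_def)
  have c0: "0 \<le> c k" and PP: "projection (P k)" if "k < m" for k
    using Pc[OF that] by auto
  have PA: "inner (P k) (A i) = inner D (A i)" for i
    using iffD1[OF Var_decomposition_iff[where P=P, OF A saP c0 c1 Dsum] V] k by simp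
  have "(\<Sum>k<m. c k *\<^sub>R P k) = (1 / \<tau>) *\<^sub>R Q"
    using Dsum by (simp only: D_def)
  from component_in_herm_on[OF Q(1) PP c0 this k] have "P k \<in> herm_on Q" .
  then have PD: "P k - D \<in> herm_on Q"
    unfolding D_def
    by (intro subspace_diff subspace_scale subspace_herm_on) (simp_all add: herm_on_def saQ QQ)
  \<comment> \<open>The identity is also among the compressed matrices; its expectation is the
    trace, equal to 1 for both.\<close>
  have P1: "inner (P k) (mat 1) = inner D (mat 1)"
  proof -
    have "complex_of_real (inner (P k) (mat 1)) = complex_of_real (inner D (mat 1))"
      using inner_mat_1[OF saP[OF k(1)]] inner_mat_1[of D] rank_one_projection_trace[of "P k"] Pc[OF k(1)]
        \<open>density_matrix D\<close>
      by (simp add: density_matrix_def psd_def)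
    then show ?thesis by simp
  qed
  have "inner (P k - D) (compress K B) = inner (P k) B - inner D B" if "selfadjoint B" for B
    using inner_compress[OF K PD[unfolded Q_def] that] by (simp add: inner_diff_left)
  then have "inner (P k - D) Y = 0" if "Y \<in> S" for Y
    using that A PA P1 by (auto simp: S_def selfadjoint_mat_1)
  then have "inner (P k - D) Y = 0" if "Y \<in> span S" for Y
    using orthogonal_to_span[OF that, of "P k - D"] by (auto simp: orthogonal_def)
  \<comment> \<open>The difference lies in the span to which it is orthogonal, so it
    vanishes.\<close>
  then have "inner (P k - D) (P k - D) = 0"
    using PD by (simp only: spanS)
  then have PkD: "P k = D" by simp
  obtain v u where vu: "P k = outer v u"
    using rank_one_imp_outer Pc[OF k(1)] by blast
  \<comment> \<open>Since \<open>D\<close> is a multiple of \<open>Q\<close> and equals a rank-one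
    matrix, the range \<open>K\<close> of \<open>Q\<close> is at most a line.\<close>
  have "K \<subseteq> vec.span {v}"
  proof
    fix x assume "x \<in> K"
    then have "Q *v x = x" using projection_fix[OF Q(1)] Q(2) by blast
    moreover have "Q = \<tau> *\<^sub>R D" using \<tau> by (simp add: D_def)
    ultimately have "x = of_real \<tau> *s (cinner u x *s v)"
      by (simp add: scaleR_matrix_vector outer_mult_vec scaleR_eq_smult flip: PkD) (simp add: vu outer_mult_vec)
    then show "x \<in> vec.span {v}" by (auto simp: vec.span_singleton)
  qed
  then have "vec.dim K \<le> card {v}"
    by (rule vec.dim_le_card) simp
  then show False using dimK by simp
qed

theorem mainTheorem1:
  fixes A :: "'r::finite \<Rightarrow> complex^'n^'n"
  assumes "\<And>i. selfadjoint (A i)"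
  shows "variance_decomposable A \<longleftrightarrow>
    (\<forall>K :: (complex^'n) set. vec.subspace K \<and> 1 < vec.dim K \<longrightarrow>
       dim (span (insert (compress K (mat 1)) (range (\<lambda>i. compress K (A i)))))
         < (vec.dim K)\<^sup>2)"
  using variance_decomposable_if_dim_less[of A, OF assms] dim_less_if_variance_decomposable[of A, OF assms]
  by blast

end
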